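(* For every integer $k\ge2$ and every rational number $x$, \[ G_{\mathcal{A}}(k;x)=(-1)^{k-1}\sum_{j=0}^{k}(-1)^j\binom{k}{j}\ell_{\mathcal{A}}(x+j+1)\quad\text{in }\mathcal{A}. \]
   Context: $\mathcal{A}\coloneqq\big(\prod_{p\text{ prime}}\mathbb{Z}/p\mathbb{Z}\big)/\big(\bigoplus_{p\text{ prime}}\mathbb{Z}/p\mathbb{Z}\big)$, a $\mathbb{Q}$-algebra via the diagonal embedding of $\mathbb{Q}$ (for the finitely many primes dividing a denominator, the $p$-component is assigned arbitrarily). Gregory polynomials $G_n(x)\in\mathbb{Q}[x]$ are defined by $\frac{t(1+t)^x}{\log(1+t)}=\sum_{n\ge0}G_n(x)t^n$. For $k\ge2$ and $x\in\mathbb{Q}$, $G_{\mathcal{A}}(k;x)\coloneqq(G_{p-k}(x)\bmod p)_p\in\mathcal{A}$. For $x\in\mathbb{Q}$, $\ell_{\mathcal{A}}(x)\coloneqq\big(\frac{x^p-x}{p}\bmod p\big)_p$ ($x$ times the Fermat quotient $\frac{x^{p-1}-1}{p}$; $\ell_{\mathcal{A}}(0)=0$). *)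

theory Defs
  imports
    "HOL-Algebra.QuotRing"
    "HOL-Algebra.Module"
    "HOL-Algebra.Product_Groups"
    "HOL-Number_Theory.Residues"
    "HOL-Number_Theory.Modular_Inverse"
    "HOL-Computational_Algebra.Formal_Power_Series"
    "HOL-Computational_Algebra.Polynomial"
begin

section \<open>The ring $\prod_p \mathbb{Z}/p\mathbb{Z} / \bigoplus_p \mathbb{Z}/p\mathbb{Z}$\<close>

definition product_ring :: "'i set \<Rightarrow> ('i \<Rightarrow> ('a, 'b) ring_scheme) \<Rightarrow> ('i \<Rightarrow> 'a) ring" where
  "product_ring I R =
     \<lparr>carrier = (\<Pi>\<^sub>E i\<in>I. carrier (R i)),
      monoid.mult = (\<lambda>x y. \<lambda>i\<in>I. x i \<otimes>\<^bsub>R i\<^esub> y i),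
      one = (\<lambda>i\<in>I. \<one>\<^bsub>R i\<^esub>),
      zero = (\<lambda>i\<in>I. \<zero>\<^bsub>R i\<^esub>),
      add = (\<lambda>x y. \<lambda>i\<in>I. x i \<oplus>\<^bsub>R i\<^esub> y i)\<rparr>"

definition direct_sum :: "'i set \<Rightarrow> ('i \<Rightarrow> ('a, 'b) ring_scheme) \<Rightarrow> ('i \<Rightarrow> 'a) set" where
  "direct_sum I R = carrier (sum_group I (\<lambda>i. add_monoid (R i)))"

abbreviation primes :: "nat set" where
  "primes \<equiv> {p. prime p}"

abbreviation F_p :: "nat \<Rightarrow> int ring" where
  "F_p p \<equiv> residue_ring (int p)"

definition A_ring :: "(nat \<Rightarrow> int) set ring" where
  "A_ring = product_ring primes F_p Quot direct_sum primes F_p"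

definition A_class :: "(nat \<Rightarrow> int) \<Rightarrow> (nat \<Rightarrow> int) set" where
  "A_class f = direct_sum primes F_p +>\<^bsub>product_ring primes F_p\<^esub> (\<lambda>p\<in>primes. f p)"

text \<open>
  The reduction of a rational number modulo \<open>p\<close>. If the prime \<open>p\<close> divides the denominator,
  \<open>modular_inverse\<close> is 0, so the value, which is arbitrary in that case, is 0.
\<close>
definition rat_mod :: "nat \<Rightarrow> rat \<Rightarrow> int" where
  "rat_mod p r =
     (let (a, b) = quotient_of r in (a * modular_inverse (int p) b) mod int p)"

definition rat_ring :: "rat ring" where
  "rat_ring = \<lparr>carrier = UNIV, monoid.mult = (*), one = 1, zero = 0, add = (+)\<rparr>"

text \<open>The ring \<open>A_ring\<close> with the scalar action of the rationals given by their diagonal embedding.\<close>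
definition A_alg :: "(rat, (nat \<Rightarrow> int) set) module" where
  "A_alg = ring.extend A_ring
     (module.fields (\<lambda>r a. A_class (\<lambda>p. rat_mod p r) \<otimes>\<^bsub>A_ring\<^esub> a))"

section \<open>Gregory polynomials\<close>

definition binomial_poly :: "nat \<Rightarrow> rat poly" where
  "binomial_poly n = Polynomial.smult (1 / fact n) (\<Prod>i<n. [:- of_nat i, 1:])"

text \<open>
  The series $t(1+t)^x/\log(1+t)$ over $\mathbb{Q}[x]$. The quotient $t/\log(1+t)$ has rational
  coefficients and is formed over the field of rationals, as power series division is not
  available over $\mathbb{Q}[x]$.
\<close>
definition Gregory_series :: "rat poly fps" where
  "Gregory_series =
     Abs_fps binomial_poly * Abs_fps (\<lambda>n. [:fps_nth (fps_X / fps_ln 1) n:])"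

definition Gregory :: "nat \<Rightarrow> rat poly" where
  "Gregory n = fps_nth Gregory_series n"

text \<open>
  The subtraction \<open>p - k\<close> is truncated; this affects only the finitely many primes \<open>p < k\<close>.
\<close>
definition G_A :: "nat \<Rightarrow> rat \<Rightarrow> (nat \<Rightarrow> int) set" where
  "G_A k x = A_class (\<lambda>p. rat_mod p (poly (Gregory (p - k)) x))"

definition ell_A :: "rat \<Rightarrow> (nat \<Rightarrow> int) set" where
  "ell_A x = A_class (\<lambda>p. rat_mod p ((x ^ p - x) / of_nat p))"

section \<open>Basic properties\<close>

lemma product_ring_simps [simp]:
  "carrier (product_ring I R) = (\<Pi>\<^sub>E i\<in>I. carrier (R i))"
  "x \<otimes>\<^bsub>product_ring I R\<^esub> y = (\<lambda>i\<in>I. x i \<otimes>\<^bsub>R i\<^esub> y i)"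
  "\<one>\<^bsub>product_ring I R\<^esub> = (\<lambda>i\<in>I. \<one>\<^bsub>R i\<^esub>)"
  "\<zero>\<^bsub>product_ring I R\<^esub> = (\<lambda>i\<in>I. \<zero>\<^bsub>R i\<^esub>)"
  "x \<oplus>\<^bsub>product_ring I R\<^esub> y = (\<lambda>i\<in>I. x i \<oplus>\<^bsub>R i\<^esub> y i)"
  by (simp_all add: product_ring_def)

lemma add_monoid_product_ring:
  "add_monoid (product_ring I R) = product_group I (\<lambda>i. add_monoid (R i))"
  by (simp add: product_ring_def product_group_def)

lemma product_ring_cring:
  assumes "\<And>i. i \<in> I \<Longrightarrow> cring (R i)"
  shows "cring (product_ring I R)"
proof -
  have r: "ring (R i)" if "i \<in> I" for i
    using assms[OF that] by (simp add: cring_def)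
  have ag: "abelian_group (R i)" if "i \<in> I" for i
    using r[OF that] by (simp add: ring_def)
  have "group (add_monoid (product_ring I R))"
    unfolding add_monoid_product_ring
    by (rule product_group) (use ag abelian_group.a_group in blast)
  then have "comm_group (add_monoid (product_ring I R))"
    by (rule group.group_comm_groupI)
       (use ag in \<open>auto simp: PiE_iff abelian_group_def abelian_monoid.a_comm
          intro!: restrict_ext\<close>)
  then have 1: "abelian_group (product_ring I R)"
    by (simp add: abelian_group.intro abelian_group_axioms.intro abelian_monoid.intro comm_group_def)
  have 2: "comm_monoid (product_ring I R)"
  proof (rule comm_monoidI)
    fix x y z
    assume x: "x \<in> carrier (product_ring I R)" and y: "y \<in> carrier (product_ring I R)"
      and z: "z \<in> carrier (product_ring I R)"
    show "x \<otimes>\<^bsub>product_ring I R\<^esub> y \<in> carrier (product_ring I R)"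
      using x y r by (auto simp: PiE_iff ring.ring_simprules)
    show "x \<otimes>\<^bsub>product_ring I R\<^esub> y \<otimes>\<^bsub>product_ring I R\<^esub> z =
        x \<otimes>\<^bsub>product_ring I R\<^esub> (y \<otimes>\<^bsub>product_ring I R\<^esub> z)"
      using x y z r by (auto intro!: restrict_ext simp: PiE_iff ring.ring_simprules)
    show "x \<otimes>\<^bsub>product_ring I R\<^esub> y = y \<otimes>\<^bsub>product_ring I R\<^esub> x"
      using x y assms by (auto intro!: restrict_ext simp: PiE_iff cring.cring_simprules(14))
    have "\<one>\<^bsub>R i\<^esub> \<otimes>\<^bsub>R i\<^esub> x i = x i" if "i \<in> I" for i
      using x r[OF that] that by (auto simp: PiE_iff ring.ring_simprules)
    then show "\<one>\<^bsub>product_ring I R\<^esub> \<otimes>\<^bsub>product_ring I R\<^esub> x = x"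
      using x by (auto simp: PiE_iff extensional_def fun_eq_iff)
  qed (use r in \<open>auto simp: ring.ring_simprules\<close>)
  show ?thesis
    using r
    by (auto intro!: cringI 1 2 restrict_ext simp: PiE_iff ring.ring_simprules)
qed

lemma cring_F_p: "prime p \<Longrightarrow> cring (F_p p)"
  using residues.cring[of "int p"] prime_gt_1_nat[of p] by (simp add: residues_def)

lemma direct_sum_ideal:
  assumes "\<And>i. i \<in> I \<Longrightarrow> cring (R i)"
  shows "ideal (direct_sum I R) (product_ring I R)"
    and "direct_sum I R = {x \<in> \<Pi>\<^sub>E i\<in>I. carrier (R i). finite {i\<in>I. x i \<noteq> \<zero>\<^bsub>R i\<^esub>}}"
proof -
  have r: "ring (R i)" if "i \<in> I" for i
    using assms[OF that] by (simp add: cring_def)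
  have g: "group (add_monoid (R i))" if "i \<in> I" for i
    using r[OF that] by (simp add: ring_def abelian_group.a_group)
  show eq: "direct_sum I R = {x \<in> \<Pi>\<^sub>E i\<in>I. carrier (R i). finite {i\<in>I. x i \<noteq> \<zero>\<^bsub>R i\<^esub>}}"
    unfolding direct_sum_def using carrier_sum_group[OF g] by simp
  show "ideal (direct_sum I R) (product_ring I R)"
  proof (rule idealI)
    show "ring (product_ring I R)"
      by (rule cring.axioms(1), rule product_ring_cring, rule assms)
    show "subgroup (direct_sum I R) (add_monoid (product_ring I R))"
      unfolding add_monoid_product_ring eq using subgroup_sum_group[OF g] by simp
  next
    fix a x assume a: "a \<in> direct_sum I R" and x: "x \<in> carrier (product_ring I R)"
    have f: "finite {i\<in>I. a i \<noteq> \<zero>\<^bsub>R i\<^esub>}" using a by (simp add: eq)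
    have "{i\<in>I. x i \<otimes>\<^bsub>R i\<^esub> a i \<noteq> \<zero>\<^bsub>R i\<^esub>} \<subseteq> {i\<in>I. a i \<noteq> \<zero>\<^bsub>R i\<^esub>}"
         "{i\<in>I. a i \<otimes>\<^bsub>R i\<^esub> x i \<noteq> \<zero>\<^bsub>R i\<^esub>} \<subseteq> {i\<in>I. a i \<noteq> \<zero>\<^bsub>R i\<^esub>}"
      using x r by (auto simp: PiE_iff ring.ring_simprules)
    then have 1: "finite {i\<in>I. x i \<otimes>\<^bsub>R i\<^esub> a i \<noteq> \<zero>\<^bsub>R i\<^esub>}"
      and 2: "finite {i\<in>I. a i \<otimes>\<^bsub>R i\<^esub> x i \<noteq> \<zero>\<^bsub>R i\<^esub>}"
      using f finite_subset by blast+
    show "x \<otimes>\<^bsub>product_ring I R\<^esub> a \<in> direct_sum I R"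
      using a x r 1 by (auto simp: eq PiE_iff ring.ring_simprules conj_commute cong: rev_conj_cong)
    show "a \<otimes>\<^bsub>product_ring I R\<^esub> x \<in> direct_sum I R"
      using a x r 2 by (auto simp: eq PiE_iff ring.ring_simprules conj_commute cong: rev_conj_cong)
  qed
qed

lemma A_ideal: "ideal (direct_sum primes F_p) (product_ring primes F_p)"
  by (rule direct_sum_ideal) (simp add: cring_F_p)

lemma cring_A_ring: "cring A_ring"
  unfolding A_ring_def
  by (intro ideal.quotient_is_cring[OF A_ideal] product_ring_cring) (simp add: cring_F_p)

lemma A_class_eq_iff:
  assumes "\<And>p. prime p \<Longrightarrow> f p \<in> {0..<int p}" "\<And>p. prime p \<Longrightarrow> g p \<in> {0..<int p}"
  shows "A_class f = A_class g \<longleftrightarrow> finite {p. prime p \<and> f p \<noteq> g p}"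
proof -
  let ?P = "product_ring primes F_p"
  interpret P: cring ?P by (rule product_ring_cring) (simp add: cring_F_p)
  let ?f = "\<lambda>p\<in>primes. f p" and ?g = "\<lambda>p\<in>primes. g p"
  have carr: "?f \<in> carrier ?P" "?g \<in> carrier ?P"
    using assms by (auto simp: residue_ring_def)
  let ?d = "\<lambda>p\<in>primes. (f p - g p) mod int p"
  have d: "?d \<in> carrier ?P"
    by (auto simp: residue_ring_def prime_gt_0_nat)
  have "((f p - g p) mod int p + g p) mod int p = f p" if "prime p" for p
    using assms(1)[OF that] by (simp add: mod_add_left_eq)
  then have f: "?f = ?d \<oplus>\<^bsub>?P\<^esub> ?g"
    by (auto simp: residue_ring_def intro!: restrict_ext)
  have "(?d \<oplus>\<^bsub>?P\<^esub> ?g) \<ominus>\<^bsub>?P\<^esub> ?g = ?d"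
    using carr(2) d by (simp only: P.minus_eq P.a_assoc P.a_inv_closed P.r_neg P.r_zero)
  then have "?f \<ominus>\<^bsub>?P\<^esub> ?g = ?d" by (simp only: f)
  moreover have "A_class f = A_class g \<longleftrightarrow> ?f \<ominus>\<^bsub>?P\<^esub> ?g \<in> direct_sum primes F_p"
    unfolding A_class_def
    using P.quotient_eq_iff_same_a_r_cos[OF A_ideal carr] by simp
  moreover have "?d \<in> direct_sum primes F_p \<longleftrightarrow> finite {p\<in>primes. ?d p \<noteq> 0}"
  proof -
    have z: "\<zero>\<^bsub>F_p p\<^esub> = 0" for p by (simp add: residue_ring_def)
    have "direct_sum primes F_p =
        {x \<in> \<Pi>\<^sub>E p\<in>primes. carrier (F_p p). finite {p\<in>primes. x p \<noteq> 0}}"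
      using direct_sum_ideal(2)[of primes F_p] by (simp add: cring_F_p z)
    then show ?thesis using d by (simp only: product_ring_simps mem_Collect_eq simp_thms)
  qed
  moreover have "{p\<in>primes. ?d p \<noteq> 0} = {p. prime p \<and> f p \<noteq> g p}"
  proof -
    have "(f p - g p) mod int p = 0 \<longleftrightarrow> f p = g p" if "prime p" for p
      using assms(1)[OF that] assms(2)[OF that] mod_eq_dvd_iff[of "f p" "int p" "g p"]
      by (simp add: dvd_eq_mod_eq_0)
    then show ?thesis by auto
  qed
  ultimately show ?thesis by simp
qed

lemma rat_mod_range: "p > 0 \<Longrightarrow> rat_mod p r \<in> {0..<int p}"
  by (simp add: rat_mod_def case_prod_unfold Let_def)

lemma rat_mod_eqI:
  assumes p: "prime p" and b: "coprime b (int p)" and r: "r = of_int a / of_int b"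
    and y: "y \<in> {0..<int p}" "[y * b = a] (mod int p)"
  shows "rat_mod p r = y"
proof -
  obtain c d where cd: "quotient_of r = (c, d)" by fastforce
  have d0: "d > 0" and cop: "coprime c d" and rcd: "r = of_int c / of_int d"
    using quotient_of_denom_pos[OF cd] quotient_of_coprime[OF cd] quotient_of_div[OF cd] by auto
  have b0: "b \<noteq> 0" using b p by auto
  have "of_int (c * b) = (of_int (a * d) :: rat)"
    using r rcd b0 d0 by (simp add: field_simps)
  then have eq: "c * b = a * d" by (simp only: of_int_eq_iff)
  have "d dvd b" using eq cop by (metis coprime_commute coprime_dvd_mult_right_iff dvd_triv_right)
  then have copd: "coprime d (int p)" using b by (metis coprime_divisors dvd_refl)
  let ?m = "modular_inverse (int p) d"
  have "c * ?m * b = a * (d * ?m)"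
    using eq by (metis mult.assoc mult.commute)
  then have "[c * ?m * b = a * (d * ?m)] (mod int p)" by (simp only: cong_refl)
  also have "[a * (d * ?m) = a * 1] (mod int p)"
    by (intro cong_mult cong_refl cong_modular_inverse1 copd)
  also have "[a * 1 = y * b] (mod int p)" using y(2) by (simp add: cong_sym)
  finally have "[c * ?m = y] (mod int p)" using b by (simp add: cong_mult_rcancel)
  then show ?thesis using y(1) by (simp add: rat_mod_def cd cong_def)
qed

lemma rat_mod_cong:
  assumes p: "prime p" and b: "coprime b (int p)" and r: "r = of_int a / of_int b"
  shows "[rat_mod p r * b = a] (mod int p)"
proof -
  let ?y = "(a * modular_inverse (int p) b) mod int p"
  have "[?y * b = a * (modular_inverse (int p) b * b)] (mod int p)"
    by (simp add: cong_def mod_simps ac_simps)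
  also have "[a * (modular_inverse (int p) b * b) = a * 1] (mod int p)"
    by (intro cong_mult cong_refl cong_modular_inverse2 b)
  finally have c: "[?y * b = a] (mod int p)" by simp
  moreover have "?y \<in> {0..<int p}" using prime_gt_0_nat[OF p] by simp
  ultimately show ?thesis using rat_mod_eqI[OF p b r] by metis
qed

lemma finite_primes_not_coprime:
  assumes "b \<noteq> 0"
  shows "finite {p::nat. prime p \<and> \<not> coprime b (int p)}"
proof -
  have "p dvd nat \<bar>b\<bar>" if "prime p" "\<not> coprime b (int p)" for p :: nat
  proof -
    have "int p dvd b"
      using that prime_imp_coprime[of "int p" b] by (auto simp: coprime_commute)
    then show ?thesis by simp
  qed
  then have "{p::nat. prime p \<and> \<not> coprime b (int p)} \<subseteq> {p. p dvd nat \<bar>b\<bar>}"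
    by blast
  then show ?thesis using assms finite_divisors_nat[of "nat \<bar>b\<bar>"] by (simp add: finite_subset)
qed

text \<open>The diagonal embedding of the rationals.\<close>

lemma rat_A_ring_hom: "(\<lambda>r. A_class (\<lambda>p. rat_mod p r)) \<in> ring_hom rat_ring A_ring"
proof -
  let ?P = "product_ring primes F_p" and ?I = "direct_sum primes F_p"
  let ?v = "\<lambda>r. \<lambda>p\<in>primes. rat_mod p r"
  have rng: "prime p \<Longrightarrow> rat_mod p r \<in> {0..<int p}" for p r
    by (rule rat_mod_range) (simp add: prime_gt_0_nat)
  have carr: "?v r \<in> carrier ?P" for r
    using rng[of _ r] by (auto simp: residue_ring_def)
  have e: "A_class (\<lambda>p. rat_mod p r) = ?I +>\<^bsub>?P\<^esub> ?v r" for r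
    by (simp add: A_class_def)
  note hom = ideal.rcos_ring_hom[OF A_ideal, folded A_ring_def]
  have op: "A_class (\<lambda>p. rat_mod p t) = A_class (\<lambda>p. F (rat_mod p r) (rat_mod p s) mod int p)"
    if F: "\<And>p b d a c. prime p \<Longrightarrow> coprime b (int p) \<Longrightarrow> coprime d (int p) \<Longrightarrow>
        r = of_int a / of_int b \<Longrightarrow> s = of_int c / of_int d \<Longrightarrow>
        rat_mod p t = F (rat_mod p r) (rat_mod p s) mod int p"
    for t r s and F :: "int \<Rightarrow> int \<Rightarrow> int"
  proof -
    obtain a b where ab: "quotient_of r = (a, b)" by fastforce
    obtain c d where cd: "quotient_of s = (c, d)" by fastforce
    note * = quotient_of_denom_pos[OF ab] quotient_of_div[OF ab]
      quotient_of_denom_pos[OF cd] quotient_of_div[OF cd]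
    have "{p. prime p \<and> rat_mod p t \<noteq> F (rat_mod p r) (rat_mod p s) mod int p} \<subseteq>
        {p. prime p \<and> \<not> coprime b (int p)} \<union> {p. prime p \<and> \<not> coprime d (int p)}"
      using F *(2,4) by blast
    moreover have "finite \<dots>" using *(1,3) finite_primes_not_coprime[of b] finite_primes_not_coprime[of d] by simp
    ultimately have "finite {p. prime p \<and> rat_mod p t \<noteq> F (rat_mod p r) (rat_mod p s) mod int p}"
      using finite_subset by blast
    then show ?thesis
      by (subst A_class_eq_iff) (simp_all add: rng[simplified] prime_gt_0_nat)
  qed
  show ?thesis
  proof (rule ring_hom_memI)
    fix r show "A_class (\<lambda>p. rat_mod p r) \<in> carrier A_ring"
      unfolding e using ring_hom_closed[OF hom carr] .
  next
    fix r s
    have "A_class (\<lambda>p. rat_mod p (r * s)) = A_class (\<lambda>p. (rat_mod p r * rat_mod p s) mod int p)"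
    proof (rule op)
      fix p b d a c
      assume p: "prime p" and b: "coprime b (int p)" and d: "coprime d (int p)"
        and r: "r = of_int a / of_int b" and s: "s = of_int c / of_int d"
      have "[(rat_mod p r * rat_mod p s) mod int p * (b * d) = (rat_mod p r * rat_mod p s) * (b * d)] (mod int p)"
        by (simp add: cong_def mod_mult_left_eq)
      also have "(rat_mod p r * rat_mod p s) * (b * d) = (rat_mod p r * b) * (rat_mod p s * d)"
        by simp
      also have "[(rat_mod p r * b) * (rat_mod p s * d) = a * c] (mod int p)"
        by (intro cong_mult rat_mod_cong p b d r s)
      finally show "rat_mod p (r * s) = (rat_mod p r * rat_mod p s) mod int p"
        by (intro rat_mod_eqI[where b = "b * d" and a = "a * c"])
           (simp_all add: p b d r s prime_gt_0_nat)
    qed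
    also have "\<dots> = ?I +>\<^bsub>?P\<^esub> (?v r \<otimes>\<^bsub>?P\<^esub> ?v s)"
      unfolding A_class_def by (intro arg_cong[where f = "\<lambda>x. ?I +>\<^bsub>?P\<^esub> x"]) (auto simp: residue_ring_def)
    also have "\<dots> = A_class (\<lambda>p. rat_mod p r) \<otimes>\<^bsub>A_ring\<^esub> A_class (\<lambda>p. rat_mod p s)"
      unfolding e using ring_hom_mult[OF hom carr carr] .
    finally show "A_class (\<lambda>p. rat_mod p (r \<otimes>\<^bsub>rat_ring\<^esub> s)) =
        A_class (\<lambda>p. rat_mod p r) \<otimes>\<^bsub>A_ring\<^esub> A_class (\<lambda>p. rat_mod p s)"
      by (simp add: rat_ring_def)
  next
    fix r s
    have "A_class (\<lambda>p. rat_mod p (r + s)) = A_class (\<lambda>p. (rat_mod p r + rat_mod p s) mod int p)"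
    proof (rule op)
      fix p b d a c
      assume p: "prime p" and b: "coprime b (int p)" and d: "coprime d (int p)"
        and r: "r = of_int a / of_int b" and s: "s = of_int c / of_int d"
      have nz: "b \<noteq> 0" "d \<noteq> 0" using b d p by auto
      have "[(rat_mod p r + rat_mod p s) mod int p * (b * d) = (rat_mod p r + rat_mod p s) * (b * d)] (mod int p)"
        by (simp add: cong_def mod_mult_left_eq)
      also have "(rat_mod p r + rat_mod p s) * (b * d) = (rat_mod p r * b) * d + (rat_mod p s * d) * b"
        by (simp add: algebra_simps)
      also have "[(rat_mod p r * b) * d + (rat_mod p s * d) * b = a * d + c * b] (mod int p)"
        by (intro cong_mult cong_add cong_refl rat_mod_cong p b d r s)
      finally show "rat_mod p (r + s) = (rat_mod p r + rat_mod p s) mod int p"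
        by (intro rat_mod_eqI[where b = "b * d" and a = "a * d + c * b"])
           (simp_all add: p b d r s nz prime_gt_0_nat add_frac_eq)
    qed
    also have "\<dots> = ?I +>\<^bsub>?P\<^esub> (?v r \<oplus>\<^bsub>?P\<^esub> ?v s)"
      unfolding A_class_def by (intro arg_cong[where f = "\<lambda>x. ?I +>\<^bsub>?P\<^esub> x"]) (auto simp: residue_ring_def)
    also have "\<dots> = A_class (\<lambda>p. rat_mod p r) \<oplus>\<^bsub>A_ring\<^esub> A_class (\<lambda>p. rat_mod p s)"
      unfolding e using ring_hom_add[OF hom carr carr] .
    finally show "A_class (\<lambda>p. rat_mod p (r \<oplus>\<^bsub>rat_ring\<^esub> s)) =
        A_class (\<lambda>p. rat_mod p r) \<oplus>\<^bsub>A_ring\<^esub> A_class (\<lambda>p. rat_mod p s)"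
      by (simp add: rat_ring_def)
  next
    have "rat_mod p 1 = 1" if "prime p" for p
      using that prime_gt_1_nat[OF that] by (intro rat_mod_eqI[where b = 1 and a = 1]) auto
    then have "?v 1 = \<one>\<^bsub>?P\<^esub>" by (auto simp: residue_ring_def intro!: restrict_ext)
    then show "A_class (\<lambda>p. rat_mod p \<one>\<^bsub>rat_ring\<^esub>) = \<one>\<^bsub>A_ring\<^esub>"
      using ring_hom_one[OF hom] by (simp add: e rat_ring_def)
  qed
qed

lemma A_alg_simps [simp]:
  "carrier A_alg = carrier A_ring"
  "x \<otimes>\<^bsub>A_alg\<^esub> y = x \<otimes>\<^bsub>A_ring\<^esub> y"
  "\<one>\<^bsub>A_alg\<^esub> = \<one>\<^bsub>A_ring\<^esub>"
  "\<zero>\<^bsub>A_alg\<^esub> = \<zero>\<^bsub>A_ring\<^esub>"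
  "x \<oplus>\<^bsub>A_alg\<^esub> y = x \<oplus>\<^bsub>A_ring\<^esub> y"
  "r \<odot>\<^bsub>A_alg\<^esub> x = A_class (\<lambda>p. rat_mod p r) \<otimes>\<^bsub>A_ring\<^esub> x"
  by (simp_all add: A_alg_def ring.defs module.defs)

lemma algebra_A_alg: "algebra rat_ring A_alg"
proof -
  interpret A: cring A_ring by (rule cring_A_ring)
  have Q: "cring rat_ring"
    by (rule cringI, rule abelian_groupI, simp_all add: rat_ring_def algebra_simps)
       (auto intro!: comm_monoidI exI[of _ "- x" for x] simp: algebra_simps)
  have "comm_monoid A_alg"
    by (rule comm_monoidI) (simp_all add: A.m_ac)
  moreover have "abelian_group A_alg"
    by (rule abelian_groupI) (simp_all add: A.a_ac A.add.l_inv_ex)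
  ultimately have M: "cring A_alg"
    by (intro cringI) (simp_all add: A.l_distr)
  note h = rat_A_ring_hom
  show ?thesis
    by (rule algebraI[OF Q M])
       (simp_all add: ring_hom_closed[OF h] ring_hom_add[OF h] ring_hom_mult[OF h] ring_hom_one[OF h]
          A.l_distr A.r_distr A.m_assoc)
qed

lemma poly_binomial_poly: "poly (binomial_poly n) x = x gchoose n"
  by (simp add: binomial_poly_def gbinomial_prod_rev poly_prod atLeast0LessThan algebra_simps)

lemma ln_dvd_X: "fps_ln (1::rat) dvd fps_X"
proof -
  have "subdegree (fps_ln (1::rat)) = 1"
    by (rule subdegreeI) (auto simp: fps_ln_def)
  moreover have "fps_ln (1::rat) \<noteq> 0"
    using calculation by auto
  ultimately show ?thesis
    by (simp add: fps_dvd_iff)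
qed

text \<open>The generating function identity, in $\mathbb{Q}[x][[t]]$ and after evaluation in $\mathbb{Q}[[t]]$.\<close>

lemma Gregory_series_mult_log:
  "Gregory_series * Abs_fps (\<lambda>n. [:fps_nth (fps_ln 1) n:]) = fps_X * Abs_fps binomial_poly"
proof -
  have lift: "Abs_fps (\<lambda>n. [:fps_nth f n:]) * Abs_fps (\<lambda>n. [:fps_nth g n:]) =
      Abs_fps (\<lambda>n. [:fps_nth (f * g) n:])" for f g :: "rat fps"
    by (rule fps_ext) (simp add: fps_mult_nth mult.commute flip: sum_to_poly)
  have "Abs_fps (\<lambda>n. [:fps_nth (fps_X :: rat fps) n:]) = fps_X"
    by (rule fps_ext) (simp add: fps_X_def one_pCons)
  then show ?thesis
    unfolding Gregory_series_def mult.assoc lift dvd_div_mult_self[OF ln_dvd_X] by (simp add: mult.commute)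
qed

lemma poly_Gregory:
  "poly (Gregory n) x = fps_nth (fps_X * fps_binomial x / fps_ln 1) n"
proof -
  have "poly (Gregory n) x = fps_nth (fps_binomial x * (fps_X / fps_ln 1)) n"
    by (simp add: Gregory_def Gregory_series_def fps_mult_nth poly_sum poly_binomial_poly mult.commute)
  also have "fps_binomial x * (fps_X / fps_ln 1) = fps_X * fps_binomial x / fps_ln 1"
    by (simp only: div_mult_swap[OF ln_dvd_X] mult.commute)
  finally show ?thesis .
qed

end

theory Submission
  imports Defs
begin

text \<open>
  Let $p$ be a large prime, let $\Delta$ be the forward difference operator, and write $H_k(x)$ for
  the value of $-\frac1p \Delta^k y^p$ at $y = x + 1$. As $\Delta^k$ kills linear polynomials for
  $k \ge 2$, $H_k(x)$ is the right-hand side of the claim at $p$. The identity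
  $\log(1 + \Delta) = D$ gives
  $\sum_{i=1}^{n+1} \frac{(-1)^{i-1}}{i} H_{p-n-1+i}(x) = -\Delta^{p-n-1} y^{p-1}|_{y = x+1}$, while
  the generating function gives
  $\sum_{i=1}^{n+1} \frac{(-1)^{i-1}}{i} G_{n+1-i}(x) = \binom{x}{n}$. By Fermat's theorem
  $\binom{x}{p-1} \equiv 1 - (x+1)^{p-1}$ modulo $p$, so applying $\Delta^{p-n-1}$ shows that the two
  right-hand sides agree modulo $p$. Hence $G_n$ and $H_{p-n}$ satisfy the same recursion modulo $p$
  for $n \le p - 2$, and $G_{p-k} \equiv H_k$.
\<close>

section \<open>Congruences of rational numbers modulo a prime\<close>

text \<open>Membership in the localization of the integers at p. The fraction need not be in lowest
  terms, so a product of two admissible denominators is again admissible.\<close>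

definition p_integral :: "nat \<Rightarrow> rat \<Rightarrow> bool" where
  "p_integral p r \<longleftrightarrow> (\<exists>a b. coprime b (int p) \<and> r = of_int a / of_int b)"

text \<open>The numbers \<open>r\<close> and \<open>s\<close> themselves may fail to be \<open>p\<close>-integral.\<close>

definition p_cong :: "nat \<Rightarrow> rat \<Rightarrow> rat \<Rightarrow> bool" where
  "p_cong p r s \<longleftrightarrow> p_integral p ((r - s) / of_nat p)"

lemma p_integral_of_int [simp]: "p_integral p (of_int a)"
  unfolding p_integral_def by (intro exI[of _ a] exI[of _ 1]) simp

lemma p_integral_of_nat [simp]: "p_integral p (of_nat n)"
  using p_integral_of_int[of p "int n"] by simp

lemma p_integral_0 [simp]: "p_integral p 0"
  and p_integral_1 [simp]: "p_integral p 1"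
  using p_integral_of_int[of p 0] p_integral_of_int[of p 1] by simp_all

lemma p_integral_mult:
  assumes "p_integral p r" "p_integral p s"
  shows "p_integral p (r * s)"
proof -
  obtain a b c d where "coprime b (int p)" "r = of_int a / of_int b"
    "coprime d (int p)" "s = of_int c / of_int d"
    using assms unfolding p_integral_def by blast
  then have "coprime (b * d) (int p)" "r * s = of_int (a * c) / of_int (b * d)"
    by simp_all
  then show ?thesis unfolding p_integral_def by blast
qed

lemma p_integral_add:
  assumes "prime p" "p_integral p r" "p_integral p s"
  shows "p_integral p (r + s)"
proof -
  obtain a b c d where *: "coprime b (int p)" "r = of_int a / of_int b"
    "coprime d (int p)" "s = of_int c / of_int d"
    using assms unfolding p_integral_def by blast
  have "b \<noteq> 0" "d \<noteq> 0" using * assms(1) by auto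
  then have "r + s = of_int (a * d + c * b) / of_int (b * d)"
    using * by (simp add: field_simps)
  moreover have "coprime (b * d) (int p)" using * by simp
  ultimately show ?thesis unfolding p_integral_def by blast
qed

lemma p_integral_minus: "p_integral p r \<Longrightarrow> p_integral p (- r)"
  using p_integral_mult[OF p_integral_of_int, of p r "- 1"] by simp

lemma p_integral_diff: "prime p \<Longrightarrow> p_integral p r \<Longrightarrow> p_integral p s \<Longrightarrow> p_integral p (r - s)"
  using p_integral_add[of p r "- s"] by (simp add: p_integral_minus)

lemma p_integral_power: "p_integral p r \<Longrightarrow> p_integral p (r ^ n)"
  by (induction n) (simp_all add: p_integral_mult)

lemma p_integral_sum:
  assumes "prime p" "\<And>i. i \<in> I \<Longrightarrow> p_integral p (f i)"
  shows "p_integral p (sum f I)"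
  using assms(2) by (induction I rule: infinite_finite_induct) (simp_all add: p_integral_add[OF assms(1)])

lemma p_integral_prod:
  assumes "\<And>i. i \<in> I \<Longrightarrow> p_integral p (f i)"
  shows "p_integral p (prod f I)"
  using assms by (induction I rule: infinite_finite_induct) (simp_all add: p_integral_mult)

lemma p_integral_inverse_of_nat:
  assumes "prime p" "\<not> p dvd n"
  shows "p_integral p (1 / of_nat n)"
proof -
  have "coprime (int n) (int p)"
    using assms prime_imp_coprime[of p n] by (simp add: coprime_commute)
  then show ?thesis
    unfolding p_integral_def by (intro exI[of _ 1] exI[of _ "int n"]) simp
qed

text \<open>Integrality passes across a congruence because r - s is p times an integral number. In
  this way the values of Gregory polynomials inherit integrality from the other side of the
  identity.\<close>

lemma p_cong_imp_integral_iff: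
  assumes "prime p" "p_cong p r s"
  shows "p_integral p r \<longleftrightarrow> p_integral p s"
proof -
  have "p_integral p (of_nat p * ((r - s) / of_nat p))"
    using assms(2) by (intro p_integral_mult) (simp_all add: p_cong_def)
  moreover have "of_nat p * ((r - s) / of_nat p) = r - s"
    using assms(1) by auto
  ultimately have "p_integral p (r - s)" by simp
  then show ?thesis
    using p_integral_add[OF assms(1), of "r - s" s] p_integral_diff[OF assms(1), of r "r - s"] by auto
qed

lemma p_cong_refl [simp]: "p_cong p r r"
  by (simp add: p_cong_def)

lemma p_cong_sym: "p_cong p r s \<Longrightarrow> p_cong p s r"
  using p_integral_minus[of p "(r - s) / of_nat p"] by (simp add: p_cong_def flip: divide_minus_left)

lemma p_cong_add:
  assumes "prime p" "p_cong p r s" "p_cong p r' s'"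
  shows "p_cong p (r + r') (s + s')"
proof -
  have "(r + r' - (s + s')) / of_nat p = (r - s) / of_nat p + (r' - s') / of_nat p"
    by (simp add: diff_divide_distrib add_divide_distrib)
  then show ?thesis using assms p_integral_add by (simp add: p_cong_def)
qed

lemma p_cong_diff:
  assumes "prime p" "p_cong p r s" "p_cong p r' s'"
  shows "p_cong p (r - r') (s - s')"
proof -
  have "(r - r' - (s - s')) / of_nat p = (r - s) / of_nat p - (r' - s') / of_nat p"
    by (simp add: diff_divide_distrib)
  then show ?thesis using assms p_integral_diff by (simp add: p_cong_def)
qed

lemma p_cong_trans:
  assumes "prime p" "p_cong p r s" "p_cong p s t"
  shows "p_cong p r t"
  using p_cong_add[OF assms] by (simp add: p_cong_def)

text \<open>The splitting rr' - ss' = r(r' - s') + s'(r - s) explains why integrality is asked of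
  \<open>r\<close> and \<open>s'\<close>.\<close>

lemma p_cong_mult:
  assumes "prime p" "p_integral p r" "p_integral p s'" "p_cong p r s" "p_cong p r' s'"
  shows "p_cong p (r * r') (s * s')"
proof -
  have "(r * r' - s * s') / of_nat p = r * ((r' - s') / of_nat p) + s' * ((r - s) / of_nat p)"
    by (simp add: diff_divide_distrib algebra_simps)
  then show ?thesis
    using assms unfolding p_cong_def by (simp only: p_integral_add p_integral_mult)
qed

lemma p_cong_mult_left:
  assumes "p_integral p c" "p_cong p r s"
  shows "p_cong p (c * r) (c * s)"
  using p_integral_mult[OF assms(1) assms(2)[unfolded p_cong_def]]
  by (simp add: p_cong_def right_diff_distrib)

lemma p_cong_sum:
  assumes "prime p" "\<And>i. i \<in> I \<Longrightarrow> p_cong p (f i) (g i)"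
  shows "p_cong p (sum f I) (sum g I)"
  using assms(2) by (induction I rule: infinite_finite_induct) (simp_all add: p_cong_add[OF assms(1)])

lemma p_cong_prod:
  assumes "prime p" "\<And>i. i \<in> I \<Longrightarrow> p_cong p (f i) (g i)" "\<And>i. i \<in> I \<Longrightarrow> p_integral p (f i)"
  shows "p_cong p (prod f I) (prod g I)"
  using assms(2,3)
proof (induction I rule: infinite_finite_induct)
  case (insert i I)
  then have "p_cong p (prod f I) (prod g I)" by simp
  moreover have "p_integral p (prod g I)"
    using p_cong_imp_integral_iff[OF assms(1) calculation] insert by (simp add: p_integral_prod)
  ultimately have "p_cong p (f i * prod f I) (g i * prod g I)"
    using insert by (intro p_cong_mult[OF assms(1)]) simp_all
  then show ?case using insert by simp
qed simp_all

lemma p_cong_power: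
  assumes "prime p" "p_integral p r" "p_cong p r s"
  shows "p_cong p (r ^ n) (s ^ n)"
  using p_cong_prod[OF assms(1), of "{..<n}" "\<lambda>_. r" "\<lambda>_. s"] assms by simp

lemma p_cong_of_int_iff:
  assumes "prime p"
  shows "p_cong p (of_int a) (of_int b) \<longleftrightarrow> [a = b] (mod int p)"
proof
  assume "[a = b] (mod int p)"
  then obtain c where "a - b = int p * c" by (auto simp: cong_iff_dvd_diff)
  then have "(of_int a - of_int b :: rat) = of_nat p * of_int c"
    by (metis of_int_diff of_int_mult of_int_of_nat_eq)
  then show "p_cong p (of_int a) (of_int b)"
    using assms by (simp add: p_cong_def)
next
  assume "p_cong p (of_int a) (of_int b)"
  then obtain c d where cd: "coprime d (int p)" "(of_int a - of_int b) / of_nat p = (of_int c / of_int d :: rat)"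
    by (auto simp: p_cong_def p_integral_def)
  have "d \<noteq> 0" "p \<noteq> 0" using cd(1) assms by auto
  then have "of_int ((a - b) * d) = (of_int (c * int p) :: rat)" using cd(2)
    by (simp add: field_simps)
  then have "int p dvd (a - b) * d" by (simp only: of_int_eq_iff) simp
  then show "[a = b] (mod int p)"
    using cd(1) by (simp add: cong_iff_dvd_diff coprime_dvd_mult_left_iff coprime_commute)
qed

section \<open>Residues of rational numbers\<close>

lemma p_cong_rat_mod:
  assumes "prime p" "p_integral p r"
  shows "p_cong p r (of_int (rat_mod p r))"
proof -
  obtain a b where b: "coprime b (int p)" and r: "r = of_int a / of_int b"
    using assms unfolding p_integral_def by blast
  have nz: "b \<noteq> 0" "p \<noteq> 0" using b assms(1) by auto
  have "[a = rat_mod p r * b] (mod int p)"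
    using rat_mod_cong[OF assms(1) b r] by (rule cong_sym)
  then obtain c where "a - rat_mod p r * b = int p * c" by (auto simp: cong_iff_dvd_diff)
  then have "of_int a - of_int (rat_mod p r) * of_int b = (of_nat p * of_int c :: rat)"
    by (metis of_int_diff of_int_mult of_int_of_nat_eq)
  moreover have "r * of_int b = of_int a" using r nz by simp
  ultimately have "(r - of_int (rat_mod p r)) * of_int b = of_nat p * of_int c"
    by (simp only: left_diff_distrib)
  then have "(r - of_int (rat_mod p r)) / of_nat p = of_int c / of_int b"
    using nz by (simp only: frac_eq_eq of_nat_eq_0_iff of_int_eq_0_iff not_False_eq_True mult.commute)
  then show ?thesis unfolding p_cong_def p_integral_def using b by blast
qed

text \<open>Congruent representatives in the range from 0 to p - 1 coincide. This translates
  equality of components in \<open>A_ring\<close> into \<open>p_cong\<close>.\<close>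

lemma rat_mod_eq_iff:
  assumes "prime p" "p_integral p r" "p_integral p s"
  shows "rat_mod p r = rat_mod p s \<longleftrightarrow> p_cong p r s"
proof
  assume "rat_mod p r = rat_mod p s"
  then show "p_cong p r s"
    using p_cong_rat_mod[OF assms(1,2)] p_cong_sym[OF p_cong_rat_mod[OF assms(1,3)]] assms(1)
    by (auto intro: p_cong_trans)
next
  assume "p_cong p r s"
  then have "p_cong p (of_int (rat_mod p r)) (of_int (rat_mod p s))"
    using p_cong_rat_mod[OF assms(1,2)] p_cong_rat_mod[OF assms(1,3)] assms(1)
    by (blast intro: p_cong_trans p_cong_sym)
  then show "rat_mod p r = rat_mod p s"
    using rat_mod_range[of p] prime_gt_0_nat[OF assms(1)]
    by (simp add: p_cong_of_int_iff[OF assms(1)] cong_def)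
qed

lemma rat_mod_of_int:
  assumes "prime p"
  shows "rat_mod p (of_int a) = a mod int p"
  by (rule rat_mod_eqI[OF assms, where b = 1 and a = a])
     (simp_all add: assms prime_gt_0_nat cong_def)

lemma rat_mod_add:
  assumes "prime p" "p_integral p r" "p_integral p s"
  shows "rat_mod p (r + s) = (rat_mod p r + rat_mod p s) mod int p"
proof -
  have "p_cong p (r + s) (of_int (rat_mod p r + rat_mod p s))"
    using p_cong_add[OF assms(1) p_cong_rat_mod p_cong_rat_mod] assms by simp
  then show ?thesis
    using assms rat_mod_eq_iff[of p "r + s" "of_int (rat_mod p r + rat_mod p s)"] rat_mod_of_int
    by (metis p_integral_add p_integral_of_int)
qed

lemma rat_mod_mult:
  assumes "prime p" "p_integral p r" "p_integral p s"
  shows "rat_mod p (r * s) = (rat_mod p r * rat_mod p s) mod int p"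
proof -
  have "p_cong p (r * s) (of_int (rat_mod p r * rat_mod p s))"
    using p_cong_mult[OF assms(1,2) _ p_cong_rat_mod p_cong_rat_mod] assms by simp
  then show ?thesis
    using assms rat_mod_eq_iff[of p "r * s" "of_int (rat_mod p r * rat_mod p s)"] rat_mod_of_int
    by (metis p_integral_mult p_integral_of_int)
qed

section \<open>Fermat's theorem and binomial coefficients modulo p\<close>

text \<open>With \<open>p_cong\<close> unfolded, this is the integrality of (r^p - r)/p, the
  component of \<open>ell_A\<close> at p. Replacing r by a natural number in its residue class
  reduces it to Fermat's theorem.\<close>

lemma p_cong_power_prime:
  assumes p: "prime p" and "p_integral p r"
  shows "p_cong p (r ^ p) r"
proof -
  have nat: "p_cong p (of_nat n ^ p) (of_nat n)" for n
  proof -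
    have "[n ^ p = n] (mod p)"
    proof (cases "p dvd n")
      case False
      then have "[n ^ (p - 1) * n = 1 * n] (mod p)"
        by (intro cong_mult cong_refl fermat_theorem p)
      then show ?thesis
        using p by (simp add: power_eq_if[of n p] mult.commute)
    next
      case True
      then have "p dvd n ^ p"
        using dvd_trans[OF True dvd_power[of p n]] prime_gt_0_nat[OF p] by simp
      with True show ?thesis by (metis cong_0_iff cong_sym cong_trans)
    qed
    then have "[int n ^ p = int n] (mod int p)"
      using cong_int_iff[of "n ^ p" n p] by simp
    then show ?thesis
      using p_cong_of_int_iff[OF p, of "int n ^ p" "int n"] by simp
  qed
  define n where "n = nat (rat_mod p r)"
  have "p_cong p r (of_nat n)"
    using p_cong_rat_mod[OF assms] rat_mod_range[of p r] p prime_gt_0_nat by (simp add: n_def)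
  then show ?thesis
    using assms nat[of n] by (blast intro: p_cong_trans p_cong_sym p_cong_power)
qed

text \<open>For n < p the factorial n! is a unit at p, so only the factors x - i have to be
  compared.\<close>

lemma p_cong_gbinomial:
  assumes "prime p" "p_integral p x" "p_cong p x y" "n < p"
  shows "p_cong p (x gchoose n) (y gchoose n)"
proof -
  have *: "z gchoose n = (1 / of_nat (fact n)) * (\<Prod>i = 0..<n. z - of_nat i)" for z :: rat
    by (simp add: gbinomial_prod_rev)
  have "p_integral p (1 / of_nat (fact n))"
    using assms by (intro p_integral_inverse_of_nat) (simp_all add: prime_dvd_fact_iff)
  then show ?thesis unfolding *
    using assms
    by (intro p_cong_mult_left p_cong_prod) (simp_all add: p_cong_diff p_integral_diff)
qed

text \<open>Both sides depend only on the residue n < p of x. For n < p - 1 the binomial coefficient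
  vanishes and Fermat's theorem gives (n+1)^(p-1) = 1 modulo p; for n = p - 1 the coefficient is 1
  and the power is divisible by p.\<close>

lemma gbinomial_pred_prime_cong:
  assumes p: "prime p" and x: "p_integral p x"
  shows "p_cong p (x gchoose (p - 1)) (1 - (x + 1) ^ (p - 1))"
proof -
  define n where "n = nat (rat_mod p x)"
  have xn: "p_cong p x (of_nat n)" and np: "n < p"
    using p_cong_rat_mod[OF p x] rat_mod_range[of p x] p prime_gt_0_nat[OF p] by (auto simp: n_def)
  have gt1: "p > 1" using p prime_gt_1_nat by simp
  have "[of_nat (n choose (p - 1)) = 1 - (int n + 1) ^ (p - 1)] (mod int p)"
  proof (cases "n = p - 1")
    case True
    have "int p dvd int p ^ (p - 1)" using gt1 by (intro dvd_power) auto
    moreover have "int n + 1 = int p" using True gt1 by simp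
    ultimately show ?thesis using True by (simp add: cong_iff_dvd_diff)
  next
    case False
    then have "\<not> p dvd n + 1" using np by (auto dest: dvd_imp_le)
    then have "[(n + 1) ^ (p - 1) = 1] (mod p)" by (rule fermat_theorem[OF p])
    then have "[(int n + 1) ^ (p - 1) = 1] (mod int p)"
      using cong_int_iff[of "(n + 1) ^ (p - 1)" 1 p] by (simp add: add.commute)
    moreover have "n choose (p - 1) = 0" using False np by simp
    ultimately show ?thesis
      using cong_diff[OF cong_refl, of "(int n + 1) ^ (p - 1)" 1 "int p" 1]
      by (simp only: cong_sym_eq[of 0] of_nat_0 diff_self cong_sym)
  qed
  then have "p_cong p (of_nat n gchoose (p - 1)) (1 - (of_nat n + 1) ^ (p - 1))"
    using p_cong_of_int_iff[OF p, of "of_nat (n choose (p - 1))" "1 - (int n + 1) ^ (p - 1)"]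
    by (simp add: binomial_gbinomial)
  moreover have "p_cong p (x gchoose (p - 1)) (of_nat n gchoose (p - 1))"
    using p x xn gt1 by (intro p_cong_gbinomial) simp_all
  moreover have "p_cong p (1 - (x + 1) ^ (p - 1)) (1 - (of_nat n + 1) ^ (p - 1))"
    using p x xn by (intro p_cong_diff p_cong_power p_integral_add p_cong_add) simp_all
  ultimately show ?thesis
    using p by (blast intro: p_cong_trans p_cong_sym)
qed

section \<open>Finite differences of powers\<close>

text \<open>\<open>fact N * diff_coeff N k y\<close> is the forward difference $\Delta^k y^N$.\<close>

definition diff_coeff :: "nat \<Rightarrow> nat \<Rightarrow> rat \<Rightarrow> rat" where
  "diff_coeff N k y = fps_nth (fps_exp y * (fps_exp 1 - 1) ^ k) N"

lemma diff_coeff_0: "diff_coeff N 0 y = y ^ N / fact N"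
  by (simp add: diff_coeff_def)

text \<open>Multiplying by e^t shifts y to y + 1 in e^(yt), so each factor e^t - 1 acts as
  \<Delta>.\<close>

lemma diff_coeff_Suc: "diff_coeff N (Suc k) y = diff_coeff N k (y + 1) - diff_coeff N k y"
proof -
  have "fps_exp y * (fps_exp 1 - 1) ^ Suc k =
      fps_exp (y + 1) * (fps_exp 1 - 1) ^ k - fps_exp y * (fps_exp 1 - 1) ^ k"
    by (simp add: fps_exp_add_mult algebra_simps)
  then show ?thesis by (simp add: diff_coeff_def)
qed

lemma fps_exp_minus_1_power_nth_eq_0:
  "n < k \<Longrightarrow> fps_nth ((fps_exp (1::rat) - 1) ^ k) n = 0"
  using startsby_zero_power_prefix[of "fps_exp (1::rat) - 1" k] by simp

text \<open>The series e^t - 1 has no constant term, so its k-th power starts at t^k. In terms of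
  differences, \<Delta>^k kills polynomials of degree below k.\<close>

lemma diff_coeff_eq_0:
  assumes "N < k"
  shows "diff_coeff N k y = 0"
  unfolding diff_coeff_def fps_mult_nth
  using assms by (intro sum.neutral) (simp add: fps_exp_minus_1_power_nth_eq_0)

text \<open>Expand (e^t - 1)^k by the binomial theorem; the exponential e^((y+j)t) contributes
  (y+j)^N / N! to the coefficient of t^N.\<close>

lemma diff_coeff_eq_sum:
  "fact N * diff_coeff N k y = (\<Sum>j\<le>k. (-1) ^ (k - j) * of_nat (k choose j) * (y + of_nat j) ^ N)"
proof -
  have "(fps_exp 1 + (- 1)) ^ k = (\<Sum>j\<le>k. of_nat (k choose j) * fps_exp (1::rat) ^ j * (- 1) ^ (k - j))"
    by (rule binomial_ring)
  then have "fps_exp y * (fps_exp 1 - 1) ^ k =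
      (\<Sum>j\<le>k. fps_const ((-1) ^ (k - j) * of_nat (k choose j)) * fps_exp (y + of_nat j))"
    by (simp add: sum_distrib_left fps_exp_power_mult fps_exp_add_mult fps_of_nat[symmetric]
        fps_const_power[symmetric] fps_const_mult[symmetric] fps_const_neg[symmetric]
        mult_ac del: fps_const_mult fps_const_power fps_const_neg)
  then have "diff_coeff N k y = (\<Sum>j\<le>k. (-1) ^ (k - j) * of_nat (k choose j) * (y + of_nat j) ^ N / fact N)"
    by (simp add: diff_coeff_def fps_sum_nth)
  then show ?thesis
    by (simp add: sum_distrib_left)
qed

text \<open>The operator identity $\log(1 + \Delta) = D$, applied to $\Delta^m y^{N+1} / (N+1)!$.\<close>

lemma sum_fps_ln_diff_coeff:
  assumes "m \<le> Suc N"
  shows "(\<Sum>i\<le>Suc N - m. fps_nth (fps_ln 1) i * diff_coeff (Suc N) (m + i) y) = diff_coeff N m y"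
proof -
  let ?E = "fps_exp (1::rat) - 1"
  let ?B = "fps_exp y * ?E ^ m"
  let ?S = "\<Sum>i\<le>Suc N. fps_const (fps_nth (fps_ln 1) i) * ?E ^ i"
  \<comment> \<open>With E = e^t - 1, the identity log(1 + E) = t may be truncated: E^i starts at
    t^i, so terms with i > N + 1 do not reach the coefficients up to t^(N+1).\<close>
  have S: "fps_nth ?S n = fps_nth fps_X n" if "n \<le> Suc N" for n
  proof -
    have "fps_ln 1 oo ?E = fps_X"
      by (simp add: fps_ln_fps_exp_inv fps_inv_fps_exp_compose)
    then have "fps_nth fps_X n = (\<Sum>i=0..n. fps_nth (fps_ln 1) i * fps_nth (?E ^ i) n)"
      by (metis fps_compose_nth)
    also have "\<dots> = (\<Sum>i\<le>Suc N. fps_nth (fps_ln 1) i * fps_nth (?E ^ i) n)"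
      using that by (intro sum.mono_neutral_left) (auto simp: fps_exp_minus_1_power_nth_eq_0)
    finally show ?thesis by (simp add: fps_sum_nth)
  qed
  have "(\<Sum>i\<le>Suc N - m. fps_nth (fps_ln 1) i * diff_coeff (Suc N) (m + i) y) =
      (\<Sum>i\<le>Suc N. fps_nth (fps_ln 1) i * diff_coeff (Suc N) (m + i) y)"
    using assms by (intro sum.mono_neutral_left) (auto simp: diff_coeff_eq_0)
  also have "\<dots> = fps_nth (?B * ?S) (Suc N)"
  proof -
    have "?B * ?S = (\<Sum>i\<le>Suc N. fps_const (fps_nth (fps_ln 1) i) * (fps_exp y * ?E ^ (m + i)))"
      by (simp only: sum_distrib_left power_add mult_ac)
    then show ?thesis
      by (simp only: diff_coeff_def fps_sum_nth fps_mult_left_const_nth)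
  qed
  also have "\<dots> = fps_nth (?B * fps_X) (Suc N)"
    unfolding fps_mult_nth by (intro sum.cong refl arg_cong2[where f = "(*)"] S) auto
  \<comment> \<open>The factor t lowers the index by one, which is D applied to
    y^(N+1)/(N+1)!.\<close>
  also have "\<dots> = diff_coeff N m y"
    by (simp add: diff_coeff_def)
  finally show ?thesis .
qed

section \<open>The two recursions and their comparison modulo p\<close>

text \<open>Compare the coefficients of t^(n+1) after multiplying the generating function by
  log(1+t), which leaves t(1+t)^x.\<close>

lemma sum_fps_ln_Gregory:
  "(\<Sum>i\<le>Suc n. fps_nth (fps_ln 1) i * poly (Gregory (Suc n - i)) x) = x gchoose n"
proof -
  let ?G = "fps_X * fps_binomial x / fps_ln (1::rat)"
  have "fps_ln (1::rat) * ?G = fps_X * fps_binomial x"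
    by (rule dvd_mult_div_cancel) (rule dvd_mult2[OF ln_dvd_X])
  then have "fps_nth (fps_ln 1 * ?G) (Suc n) = x gchoose n"
    by simp
  then show ?thesis
    by (simp only: fps_mult_nth poly_Gregory atLeast0AtMost)
qed

text \<open>Induction on k, taking differences in x. The constant 1 from Fermat's theorem is present
  only at k = 0 and disappears at the first difference; Pascal's rule lowers the binomial index. The
  case k = p - 1 is Wilson's theorem.\<close>

lemma diff_coeff_cong_gbinomial:
  assumes p: "prime p" and x: "p_integral p x" and "k < p"
  shows "p_cong p (- fact (p - 1) * diff_coeff (p - 1) k (x + 1))
    ((x gchoose (p - 1 - k)) - (if k = 0 then 1 else 0))"
  using x \<open>k < p\<close>
proof (induction k arbitrary: x)
  case 0
  have "p_cong p (- ((x + 1) ^ (p - 1))) ((x gchoose (p - 1)) - 1)"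
    using p_cong_diff[OF p p_cong_sym[OF gbinomial_pred_prime_cong[OF p 0(1)]], of 1 1] by simp
  then show ?case by (simp add: diff_coeff_0)
next
  case (Suc k)
  let ?c = "if k = 0 then 1 else 0 :: rat"
  let ?d = "\<lambda>y. - fact (p - 1) * diff_coeff (p - 1) k y"
  have "p_cong p (?d (x + 1 + 1)) ((x + 1 gchoose (p - 1 - k)) - ?c)"
    using Suc p by (intro Suc.IH) (simp_all add: p_integral_add)
  moreover have "p_cong p (?d (x + 1)) ((x gchoose (p - 1 - k)) - ?c)"
    using Suc by (intro Suc.IH) simp_all
  ultimately have "p_cong p (?d (x + 1 + 1) - ?d (x + 1))
      (((x + 1 gchoose (p - 1 - k)) - ?c) - ((x gchoose (p - 1 - k)) - ?c))"
    by (rule p_cong_diff[OF p])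
  moreover have "p - 1 - k = Suc (p - 1 - Suc k)" using Suc by simp
  then have "((x + 1 gchoose (p - 1 - k)) - ?c) - ((x gchoose (p - 1 - k)) - ?c) = x gchoose (p - 1 - Suc k)"
    by (simp add: gbinomial_Suc_Suc)
  moreover have "?d (x + 1 + 1) - ?d (x + 1) = - fact (p - 1) * diff_coeff (p - 1) (Suc k) (x + 1)"
    by (simp add: diff_coeff_Suc right_diff_distrib)
  ultimately show ?case by simp
qed

text \<open>Strong induction along the common recursion. The bound on n makes p - 1 - n positive, so
  the exceptional constant of \<open>diff_coeff_cong_gbinomial\<close> is absent, and it makes 1/i
  integral at p for 1 \<le> i \<le> n + 1.\<close>

lemma Gregory_cong_diff_coeff:
  assumes p: "prime p" and x: "p_integral p x" and "n + 2 \<le> p"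
  shows "p_cong p (poly (Gregory n) x) (- fact (p - 1) * diff_coeff p (p - n) (x + 1))"
  using \<open>n + 2 \<le> p\<close>
proof (induction n rule: less_induct)
  case (less n)
  let ?l = "fps_nth (fps_ln (1::rat))"
  let ?g = "\<lambda>m. poly (Gregory m) x"
  let ?h = "\<lambda>m. - fact (p - 1) * diff_coeff p (p - m) (x + 1)"
  let ?R = "\<lambda>f. \<Sum>i\<in>{2..Suc n}. ?l i * f (Suc n - i)"
  \<comment> \<open>The series log(1+t) has constant term 0 and linear coefficient 1, so the term i
    = 1 isolates \<open>f n\<close> and the rest involves only smaller indices.\<close>
  have split: "(\<Sum>i\<le>Suc n. ?l i * f (Suc n - i)) = f n + ?R f" for f
  proof -
    have "{..Suc n} = insert 0 (insert 1 {2..Suc n})" by auto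
    then show ?thesis by (simp add: fps_ln_nth)
  qed
  have g: "?g n = (x gchoose n) - ?R ?g"
    using split[of ?g] unfolding sum_fps_ln_Gregory by (simp only: eq_diff_eq)
  \<comment> \<open>Since \<open>p - (Suc n - i)\<close> equals \<open>p - 1 - n + i\<close>, the
    operator identity applies with N = p - 1 and m = p - 1 - n.\<close>
  have "(\<Sum>i\<le>Suc n. ?l i * ?h (Suc n - i)) =
      - fact (p - 1) * (\<Sum>i\<le>Suc n. ?l i * diff_coeff p (p - 1 - n + i) (x + 1))"
    unfolding sum_distrib_left using less.prems by (intro sum.cong) (auto simp: mult_ac)
  also have "(\<Sum>i\<le>Suc n. ?l i * diff_coeff p (p - 1 - n + i) (x + 1)) =
      diff_coeff (p - 1) (p - 1 - n) (x + 1)"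
  proof -
    have "Suc (p - 1) = p" "p - (p - 1 - n) = Suc n" using less.prems by auto
    then show ?thesis
      using sum_fps_ln_diff_coeff[of "p - 1 - n" "p - 1" "x + 1"] by simp
  qed
  finally have h: "?h n = - fact (p - 1) * diff_coeff (p - 1) (p - 1 - n) (x + 1) - ?R ?h"
    using split[of ?h] by (simp only: eq_diff_eq)
  have "p_cong p (x gchoose n) (- fact (p - 1) * diff_coeff (p - 1) (p - 1 - n) (x + 1))"
    using p_cong_sym[OF diff_coeff_cong_gbinomial[OF p x, of "p - 1 - n"]] less.prems
    by auto
  moreover have "p_cong p (?R ?g) (?R ?h)"
  proof (intro p_cong_sum[OF p] p_cong_mult_left)
    fix i assume i: "i \<in> {2..Suc n}"
    have "p_integral p ((- 1) ^ (i - 1) * (1 / of_nat i))"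
      using i less.prems p
      by (intro p_integral_mult p_integral_power p_integral_minus p_integral_inverse_of_nat)
         (auto dest: dvd_imp_le)
    then show "p_integral p (?l i)"
      using i by (simp add: fps_ln_nth)
    show "p_cong p (?g (Suc n - i)) (?h (Suc n - i))"
      using i less.prems by (intro less.IH) auto
  qed
  ultimately show ?case
    unfolding g h by (rule p_cong_diff[OF p])
qed

text \<open>An exact identity over the rationals: up to sign the sum is \<Delta>^k applied to (y^p -
  y)/p at y = x + 1. The linear part dies because k \<ge> 2, and p!/p = (p-1)!.\<close>

lemma fermat_quotient_sum_eq_diff_coeff:
  assumes p: "prime p" and k: "k \<ge> 2"
  shows "(- 1) ^ (k - 1) * (\<Sum>j = 0..k. (- 1) ^ j * of_nat (k choose j) *
      (((x + of_nat j + 1) ^ p - (x + of_nat j + 1)) / of_nat p)) =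
    - fact (p - 1) * diff_coeff p k (x + 1)"
proof -
  define D where "D N = (\<Sum>j\<le>k. (- 1) ^ (k - j) * of_nat (k choose j) * (x + 1 + of_nat j) ^ N)" for N
  have D: "D N = fact N * diff_coeff N k (x + 1)" for N
    by (simp only: D_def diff_coeff_eq_sum)
  have "D 1 = 0" using k by (simp add: D diff_coeff_eq_0)
  have "(- 1) ^ (k - 1) * (\<Sum>j = 0..k. (- 1) ^ j * of_nat (k choose j) *
      (((x + of_nat j + 1) ^ p - (x + of_nat j + 1)) / of_nat p)) = - (D p - D 1) / of_nat p"
  proof -
    \<comment> \<open>The exponents k - 1 + j and k - j add up to 2k - 1, so they have opposite
      parity.\<close>
    have sign: "(- 1) ^ (k - 1) * (- 1) ^ j = (- ((- 1) ^ (k - j)) :: rat)" if "j \<le> k" for j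
      using k that by (cases "even k"; cases "even j") (simp_all add: even_diff_nat uminus_power_if)
    have "(- 1) ^ (k - 1) * ((- 1) ^ j * of_nat (k choose j) *
        (((x + of_nat j + 1) ^ p - (x + of_nat j + 1)) / of_nat p)) =
        - ((- 1) ^ (k - j) * of_nat (k choose j) * (x + 1 + of_nat j) ^ p -
           (- 1) ^ (k - j) * of_nat (k choose j) * (x + 1 + of_nat j) ^ 1) / of_nat p"
      if "j \<le> k" for j
    proof -
      have "(- 1) ^ (k - 1) * ((- 1) ^ j * of_nat (k choose j) *
        (((x + of_nat j + 1) ^ p - (x + of_nat j + 1)) / of_nat p)) =
        ((- 1) ^ (k - 1) * (- 1) ^ j) * (of_nat (k choose j) *
        (((x + 1 + of_nat j) ^ p - (x + 1 + of_nat j) ^ 1) / of_nat p))"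
        by (simp add: add_ac)
      also have "\<dots> = - ((- 1) ^ (k - j)) * (of_nat (k choose j) *
        (((x + 1 + of_nat j) ^ p - (x + 1 + of_nat j) ^ 1) / of_nat p))"
        by (simp only: sign[OF that])
      finally show ?thesis 
        by (simp only: mult.assoc right_diff_distrib[symmetric] times_divide_eq_right minus_mult_left)
    qed
    then show ?thesis
      unfolding D_def sum_subtractf[symmetric] sum_negf[symmetric] sum_divide_distrib sum_distrib_left
        atLeast0AtMost
      by (intro sum.cong) auto
  qed
  moreover have "fact p = of_nat p * (fact (p - 1) :: rat)"
    using fact_reduce[of p] prime_gt_0_nat[OF p] by simp
  ultimately show ?thesis
    using \<open>D 1 = 0\<close> prime_gt_0_nat[OF p] by (simp add: D)
qed

section \<open>Classes of families of rational numbers\<close>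

lemma A_class_closed:
  assumes "\<And>p. prime p \<Longrightarrow> f p \<in> {0..<int p}"
  shows "A_class f \<in> carrier A_ring"
    and "(\<lambda>p\<in>primes. f p) \<in> carrier (product_ring primes F_p)"
proof -
  show *: "(\<lambda>p\<in>primes. f p) \<in> carrier (product_ring primes F_p)"
    using assms by (auto simp: residue_ring_def)
  show "A_class f \<in> carrier A_ring"
    unfolding A_class_def A_ring_def
    using ring_hom_closed[OF ideal.rcos_ring_hom[OF A_ideal] *] .
qed

lemma A_class_mult:
  assumes "\<And>p. prime p \<Longrightarrow> f p \<in> {0..<int p}" "\<And>p. prime p \<Longrightarrow> g p \<in> {0..<int p}"
  shows "A_class f \<otimes>\<^bsub>A_ring\<^esub> A_class g = A_class (\<lambda>p. (f p * g p) mod int p)"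
proof -
  have "A_class f \<otimes>\<^bsub>A_ring\<^esub> A_class g = direct_sum primes F_p +>\<^bsub>product_ring primes F_p\<^esub>
      ((\<lambda>p\<in>primes. f p) \<otimes>\<^bsub>product_ring primes F_p\<^esub> (\<lambda>p\<in>primes. g p))"
    using ring_hom_mult[OF ideal.rcos_ring_hom[OF A_ideal] A_class_closed(2) A_class_closed(2)] assms
    unfolding A_class_def A_ring_def by simp
  moreover have "(\<lambda>p\<in>primes. f p) \<otimes>\<^bsub>product_ring primes F_p\<^esub> (\<lambda>p\<in>primes. g p) =
      (\<lambda>p\<in>primes. (f p * g p) mod int p)"
    by (auto simp: residue_ring_def)
  ultimately show ?thesis by (simp only: A_class_def)
qed

lemma A_class_add:
  assumes "\<And>p. prime p \<Longrightarrow> f p \<in> {0..<int p}" "\<And>p. prime p \<Longrightarrow> g p \<in> {0..<int p}"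
  shows "A_class f \<oplus>\<^bsub>A_ring\<^esub> A_class g = A_class (\<lambda>p. (f p + g p) mod int p)"
proof -
  have "A_class f \<oplus>\<^bsub>A_ring\<^esub> A_class g = direct_sum primes F_p +>\<^bsub>product_ring primes F_p\<^esub>
      ((\<lambda>p\<in>primes. f p) \<oplus>\<^bsub>product_ring primes F_p\<^esub> (\<lambda>p\<in>primes. g p))"
    using ring_hom_add[OF ideal.rcos_ring_hom[OF A_ideal] A_class_closed(2) A_class_closed(2)] assms
    unfolding A_class_def A_ring_def by simp
  moreover have "(\<lambda>p\<in>primes. f p) \<oplus>\<^bsub>product_ring primes F_p\<^esub> (\<lambda>p\<in>primes. g p) =
      (\<lambda>p\<in>primes. (f p + g p) mod int p)"
    by (auto simp: residue_ring_def)
  ultimately show ?thesis by (simp only: A_class_def)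
qed

section \<open>Families considered up to finitely many primes\<close>

text \<open>As a filter, it lets the finite exceptional sets of several conditions be merged by
  \<open>eventually_elim\<close>.\<close>

abbreviation almost_all_primes :: "nat filter" where
  "almost_all_primes \<equiv> inf cofinite (principal primes)"

abbreviation A_rat_class :: "(nat \<Rightarrow> rat) \<Rightarrow> (nat \<Rightarrow> int) set" where
  "A_rat_class f \<equiv> A_class (\<lambda>p. rat_mod p (f p))"

lemma eventually_almost_all_primes:
  "eventually P almost_all_primes \<longleftrightarrow> finite {p. prime p \<and> \<not> P p}"
  by (simp add: eventually_inf_principal eventually_cofinite)

lemma eventually_prime: "eventually prime almost_all_primes"
  by (simp add: eventually_almost_all_primes)

lemma eventually_p_integral: "\<forall>\<^sub>F p in almost_all_primes. p_integral p r"
proof -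
  obtain a b where ab: "quotient_of r = (a, b)" by fastforce
  then have "b \<noteq> 0" "r = of_int a / of_int b"
    using quotient_of_denom_pos[OF ab] quotient_of_div[OF ab] by auto
  then have "finite {p::nat. prime p \<and> \<not> coprime b (int p)}"
    and "{p. prime p \<and> \<not> p_integral p r} \<subseteq> {p::nat. prime p \<and> \<not> coprime b (int p)}"
    using finite_primes_not_coprime by (auto simp: p_integral_def)
  then show ?thesis
    unfolding eventually_almost_all_primes by (metis finite_subset)
qed

lemma rat_mod_in_range: "prime p \<Longrightarrow> rat_mod p r \<in> {0..<int p}"
  by (rule rat_mod_range[OF prime_gt_0_nat])

lemma A_rat_class_closed: "A_rat_class f \<in> carrier A_ring"
  by (rule A_class_closed(1)[OF rat_mod_in_range])

text \<open>Equality in \<open>A_ring\<close> ignores finitely many primes, and the integrality of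
  \<open>f p\<close> follows from that of \<open>g p\<close> through the congruence.\<close>

lemma A_rat_class_eqI:
  assumes "\<forall>\<^sub>F p in almost_all_primes. p_integral p (g p)"
    and "\<forall>\<^sub>F p in almost_all_primes. p_cong p (f p) (g p)"
  shows "A_rat_class f = A_rat_class g"
proof -
  have "\<forall>\<^sub>F p in almost_all_primes. rat_mod p (f p) = rat_mod p (g p)"
    using assms eventually_prime
    by eventually_elim (simp add: rat_mod_eq_iff p_cong_imp_integral_iff)
  then show ?thesis
    by (simp only: A_class_eq_iff[OF rat_mod_in_range rat_mod_in_range] eventually_almost_all_primes)
qed

lemma A_rat_class_mult:
  assumes "\<forall>\<^sub>F p in almost_all_primes. p_integral p (f p)"
    and "\<forall>\<^sub>F p in almost_all_primes. p_integral p (g p)"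
  shows "A_rat_class f \<otimes>\<^bsub>A_ring\<^esub> A_rat_class g = A_rat_class (\<lambda>p. f p * g p)"
proof -
  have "\<forall>\<^sub>F p in almost_all_primes. (rat_mod p (f p) * rat_mod p (g p)) mod int p = rat_mod p (f p * g p)"
    using assms eventually_prime by eventually_elim (simp add: rat_mod_mult)
  then have "A_class (\<lambda>p. (rat_mod p (f p) * rat_mod p (g p)) mod int p) = A_rat_class (\<lambda>p. f p * g p)"
    unfolding eventually_almost_all_primes
    by (subst A_class_eq_iff) (simp_all add: rat_mod_in_range[simplified] prime_gt_0_nat)
  then show ?thesis
    using A_class_mult[of "\<lambda>p. rat_mod p (f p)" "\<lambda>p. rat_mod p (g p)", OF rat_mod_in_range rat_mod_in_range]
    by simp
qed

lemma A_rat_class_add: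
  assumes "\<forall>\<^sub>F p in almost_all_primes. p_integral p (f p)"
    and "\<forall>\<^sub>F p in almost_all_primes. p_integral p (g p)"
  shows "A_rat_class f \<oplus>\<^bsub>A_ring\<^esub> A_rat_class g = A_rat_class (\<lambda>p. f p + g p)"
proof -
  have "\<forall>\<^sub>F p in almost_all_primes. (rat_mod p (f p) + rat_mod p (g p)) mod int p = rat_mod p (f p + g p)"
    using assms eventually_prime by eventually_elim (simp add: rat_mod_add)
  then have "A_class (\<lambda>p. (rat_mod p (f p) + rat_mod p (g p)) mod int p) = A_rat_class (\<lambda>p. f p + g p)"
    unfolding eventually_almost_all_primes
    by (subst A_class_eq_iff) (simp_all add: rat_mod_in_range[simplified] prime_gt_0_nat)
  then show ?thesis
    using A_class_add[of "\<lambda>p. rat_mod p (f p)" "\<lambda>p. rat_mod p (g p)", OF rat_mod_in_range rat_mod_in_range]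
    by simp
qed

text \<open>A scalar acts through its diagonal class, and a fixed rational is integral at almost all
  primes, so this is a product of classes.\<close>

lemma A_rat_class_smult:
  assumes "\<forall>\<^sub>F p in almost_all_primes. p_integral p (f p)"
  shows "r \<odot>\<^bsub>A_alg\<^esub> A_rat_class f = A_rat_class (\<lambda>p. r * f p)"
  using A_rat_class_mult[OF eventually_p_integral assms] by simp

lemma eventually_p_integral_mult:
  assumes "\<forall>\<^sub>F p in almost_all_primes. p_integral p (f p)"
  shows "\<forall>\<^sub>F p in almost_all_primes. p_integral p (r * f p)"
  using assms eventually_p_integral[of r] by eventually_elim (rule p_integral_mult)

lemma eventually_p_integral_sum:
  assumes "finite J" "\<And>j. j \<in> J \<Longrightarrow> \<forall>\<^sub>F p in almost_all_primes. p_integral p (f j p)"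
  shows "\<forall>\<^sub>F p in almost_all_primes. p_integral p (\<Sum>j\<in>J. f j p)"
proof -
  have "\<forall>\<^sub>F p in almost_all_primes. \<forall>j\<in>J. p_integral p (f j p)"
    using assms by (simp add: eventually_ball_finite)
  then show ?thesis
    using eventually_prime by eventually_elim (simp add: p_integral_sum)
qed

lemma A_rat_class_finsum:
  assumes "finite J" "\<And>j. j \<in> J \<Longrightarrow> \<forall>\<^sub>F p in almost_all_primes. p_integral p (f j p)"
  shows "(\<Oplus>\<^bsub>A_alg\<^esub>j\<in>J. A_rat_class (f j)) = A_rat_class (\<lambda>p. \<Sum>j\<in>J. f j p)"
proof -
  interpret A: algebra rat_ring A_alg by (rule algebra_A_alg)
  show ?thesis using assms
  proof (induction J)
    case empty
    have "A_rat_class (\<lambda>p. 0) = \<zero>\<^bsub>A_ring\<^esub>"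
    proof -
      interpret R: cring A_ring by (rule cring_A_ring)
      \<comment> \<open>The class of 0 is idempotent under addition, so cancellation in the additive
        group makes it the zero element.\<close>
      have "A_rat_class (\<lambda>p. 0) \<oplus>\<^bsub>A_ring\<^esub> A_rat_class (\<lambda>p. 0) = A_rat_class (\<lambda>p. 0)"
        using A_rat_class_add[of "\<lambda>p. 0" "\<lambda>p. 0"] by simp
      then show ?thesis
        using A_rat_class_closed[of "\<lambda>p. 0"] R.add.l_cancel_one by simp
    qed
    then show ?case by simp
  next
    case (insert j J)
    have "(\<Oplus>\<^bsub>A_alg\<^esub>j\<in>insert j J. A_rat_class (f j)) =
        A_rat_class (f j) \<oplus>\<^bsub>A_ring\<^esub> A_rat_class (\<lambda>p. \<Sum>j\<in>J. f j p)"
      using insert A_rat_class_closed by (simp add: Pi_def)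
    also have "\<dots> = A_rat_class (\<lambda>p. \<Sum>j\<in>insert j J. f j p)"
      using insert eventually_p_integral_sum[of J f] by (simp add: A_rat_class_add)
    finally show ?case .
  qed
qed

theorem theorem3p8:
  fixes k :: nat and x :: rat
  assumes "k \<ge> 2"
  shows "G_A k x =
    (- 1) ^ (k - 1) \<odot>\<^bsub>A_alg\<^esub>
      (\<Oplus>\<^bsub>A_alg\<^esub>j\<in>{0..k}. ((- 1) ^ j * of_nat (k choose j)) \<odot>\<^bsub>A_alg\<^esub> ell_A (x + of_nat j + 1))"
proof -
  define q where "q j p = ((x + of_nat j + 1) ^ p - (x + of_nat j + 1)) / of_nat p" for j p
  define c :: "nat \<Rightarrow> rat" where "c j = (- 1) ^ j * of_nat (k choose j)" for j
  have q: "\<forall>\<^sub>F p in almost_all_primes. p_integral p (q j p)" for j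
    using eventually_p_integral[of "x + of_nat j + 1"] eventually_prime
    by eventually_elim (use p_cong_power_prime in \<open>simp add: q_def p_cong_def\<close>)
  have cq: "\<forall>\<^sub>F p in almost_all_primes. p_integral p (\<Sum>j=0..k. c j * q j p)"
    by (intro eventually_p_integral_sum eventually_p_integral_mult q) simp
  have "(\<Oplus>\<^bsub>A_alg\<^esub>j\<in>{0..k}. c j \<odot>\<^bsub>A_alg\<^esub> ell_A (x + of_nat j + 1)) =
      (\<Oplus>\<^bsub>A_alg\<^esub>j\<in>{0..k}. A_rat_class (\<lambda>p. c j * q j p))"
    unfolding ell_A_def q_def[symmetric] by (simp only: A_rat_class_smult[OF q])
  also have "\<dots> = A_rat_class (\<lambda>p. \<Sum>j=0..k. c j * q j p)"
    by (intro A_rat_class_finsum eventually_p_integral_mult q) simp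
  finally have "(- 1) ^ (k - 1) \<odot>\<^bsub>A_alg\<^esub> (\<Oplus>\<^bsub>A_alg\<^esub>j\<in>{0..k}. c j \<odot>\<^bsub>A_alg\<^esub> ell_A (x + of_nat j + 1)) =
      A_rat_class (\<lambda>p. (- 1) ^ (k - 1) * (\<Sum>j=0..k. c j * q j p))"
    by (simp only: A_rat_class_smult[OF cq])
  also have "\<dots> = G_A k x"
    unfolding G_A_def
  \<comment> \<open>The orientation is chosen so that integrality has to be shown for the sum of
    Fermat quotients, where it is known.\<close>
  proof (rule A_rat_class_eqI[symmetric])
    show "\<forall>\<^sub>F p in almost_all_primes. p_integral p ((- 1) ^ (k - 1) * (\<Sum>j=0..k. c j * q j p))"
      by (rule eventually_p_integral_mult[OF cq])
    \<comment> \<open>This discards the finitely many primes at which the subtraction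
      \<open>p - k\<close> is truncated.\<close>
    have "finite {p. prime p \<and> \<not> k \<le> p}"
      by (rule finite_subset[of _ "{..<k}"]) auto
    then have "\<forall>\<^sub>F p in almost_all_primes. k \<le> p"
      by (simp only: eventually_almost_all_primes)
    then show "\<forall>\<^sub>F p in almost_all_primes. p_cong p (poly (Gregory (p - k)) x)
        ((- 1) ^ (k - 1) * (\<Sum>j=0..k. c j * q j p))"
      using eventually_prime eventually_p_integral[of x]
    proof eventually_elim
      case (elim p)
      \<comment> \<open>For n = p - k, the bound n + 2 \<le> p amounts to k \<ge> 2, and p - n = k
        gives the difference of order k.\<close>
      have "p - k + 2 \<le> p" "p - (p - k) = k" using elim(1) assms by auto
      then show ?case
        using Gregory_cong_diff_coeff[of p x "p - k"] elim(2,3)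
          fermat_quotient_sum_eq_diff_coeff[OF elim(2) assms, of x]
        by (simp only: c_def q_def)
    qed
  qed
  finally show ?thesis by (simp only: c_def)
qed

end
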